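(* Let $d\ge 2$. For $r\in(0,1)$ let $M_1,M_2\subset\mathbb{R}^d$ be the closed balls of radius $r$ with centers $\mathbf{x}_1=(-1,0,\dots,0)$ and $\mathbf{x}_2=(1,0,\dots,0)$, let $V_1,V_2$ be independent standard $d$-dimensional normal $\mathcal{N}(\mathbf{0},I_d)$ random vectors, and let $C$ be the collision location of the moving balls $M_1+sV_1$ and $M_2+sV_2$, $s\ge 0$. Suppose that $A\subset\mathbb{R}^d$ is a bounded Borel set with a positive distance from the origin. Then $$\lim_{r\to0}\mathbb{P}(C\in A)\,r^{1-d}=\frac{\pi^{-(d+1)/2}\,\Gamma(d)}{2\,\Gamma(d/2+1/2)}\int_A\frac{1}{\left(1+|x|^2\right)^d}\,dx .$$
   Context: Write $M_i(s)=M_i+sV_i$ for $i=1,2$ and $s\ge0$. The collision time is $T=\inf\{t\ge0: M_1(t)\cap M_2(t)\neq\emptyset\}$ (with $\inf\emptyset=\infty$). On the event $T<\infty$ the collision location $C$ is the unique point of $M_1(T)\cap M_2(T)$. Since $C$ is defined only when $T<\infty$, $\mathbb{P}(C\in A)$ means $\mathbb{P}(T<\infty \text{ and } C\in A)$ (so $C$ has a defective distribution). All these quantities depend on $r$. $|\cdot|$ is the Euclidean norm. *)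

theory Defs
  imports "HOL-Probability.Probability"
begin

definition moving :: "'a::real_vector set \<Rightarrow> 'a \<Rightarrow> real \<Rightarrow> 'a set" where
  "moving M v s = (\<lambda>x. x + s *\<^sub>R v) ` M"

definition collision_time ::
  "'a::real_vector set \<Rightarrow> 'a set \<Rightarrow> 'a \<Rightarrow> 'a \<Rightarrow> ereal" where
  "collision_time M1 M2 v1 v2 =
     Inf (ereal ` {t. 0 \<le> t \<and> moving M1 v1 t \<inter> moving M2 v2 t \<noteq> {}})"

text \<open>The collision location is meaningful only if the collision time is finite and the two
  bodies then meet in exactly one point; for disjoint closed balls of positive radius the
  second condition follows from the first.\<close>

definition collision_location ::
  "'a::real_vector set \<Rightarrow> 'a set \<Rightarrow> 'a \<Rightarrow> 'a \<Rightarrow> 'a" where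
  "collision_location M1 M2 v1 v2 =
     (let T = real_of_ereal (collision_time M1 M2 v1 v2)
      in THE c. c \<in> moving M1 v1 T \<inter> moving M2 v2 T)"

text \<open>The law \<open>N(0, I)\<close>: the coordinates are independent standard normal variables, so the
  density with respect to Lebesgue measure is the product of the one-dimensional ones.\<close>

definition std_normal_vec_density :: "real ^ 'n \<Rightarrow> real" where
  "std_normal_vec_density x = (\<Prod>i\<in>UNIV. std_normal_density (x $ i))"

end

theory Submission
  imports Defs
begin

text \<open>In the independent \<open>N(0, I / 2)\<close> variables \<open>u = (V1 - V2) / 2\<close> and \<open>y = (V1 + V2) / 2\<close> the
  balls touch at the first time \<open>T\<close> at which \<open>T u\<close> reaches the ball of radius \<open>r\<close> around the first
  unit vector \<open>e\<close>, and the contact point is \<open>T y\<close>. Hence the probability is the integral over the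
  thin cone of hitting directions \<open>u\<close> of a Gaussian weight times \<open>P(T y \<in> A)\<close>. Compressing the
  \<open>d - 1\<close> directions orthogonal to \<open>e\<close> by the factor \<open>r\<close> produces the Jacobian \<open>r ^ (d - 1)\<close> and opens the
  cone up to the fixed cone \<open>norm z \<le> t\<close>, where \<open>t = u \<bullet> e\<close>, \<open>z\<close> is the orthogonal component of \<open>u\<close>, and
  \<open>1 / T\<close> tends to \<open>t\<close>. Dominated convergence and integration over the slices of the cone
  reduce the limit to a one-dimensional Gaussian moment.\<close>

section \<open>Collision of two balls\<close>

lemma moving_cball:
  fixes a v :: "'a::real_normed_vector"
  shows "moving (cball a r) v s = cball (a + s *\<^sub>R v) r"
proof (intro set_eqI iffI)
  fix x assume "x \<in> cball (a + s *\<^sub>R v) r"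
  then have "x - s *\<^sub>R v \<in> cball a r" by (simp add: dist_norm algebra_simps)
  then show "x \<in> moving (cball a r) v s"
    unfolding moving_def by (intro image_eqI[of _ _ "x - s *\<^sub>R v"]) auto
qed (auto simp: moving_def)

text \<open>The centres are \<open>2 * norm h\<close> apart, so the triangle inequality gives one
  direction; for the other, the midpoint \<open>m\<close> lies in both balls.\<close>

lemma cball_Int_cball_nonempty_iff:
  fixes m h :: "'a::real_normed_vector"
  shows "cball (m - h) r \<inter> cball (m + h) r \<noteq> {} \<longleftrightarrow> norm h \<le> r"
proof
  assume "cball (m - h) r \<inter> cball (m + h) r \<noteq> {}"
  then obtain c where "dist (m - h) c \<le> r" "dist (m + h) c \<le> r" by auto
  then have "dist (m - h) (m + h) \<le> r + r"
    by (metis add_mono dist_commute dist_triangle order_trans)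
  moreover have "dist (m - h) (m + h) = 2 * norm h"
    using norm_scaleR[of 2 h] by (simp add: dist_norm norm_minus_commute scaleR_2)
  ultimately show "norm h \<le> r" by simp
next
  assume "norm h \<le> r"
  then have "m \<in> cball (m - h) r \<inter> cball (m + h) r" by (simp add: dist_norm)
  then show "cball (m - h) r \<inter> cball (m + h) r \<noteq> {}" by blast
qed

text \<open>Uniqueness of the contact point is strict convexity of the ball, obtained here from the
  parallelogram law; this is where an inner product enters.\<close>

lemma cball_Int_cball_tangent:
  fixes m h :: "'a::real_inner"
  assumes "norm h = r"
  shows "cball (m - h) r \<inter> cball (m + h) r = {m}"
proof
  show "cball (m - h) r \<inter> cball (m + h) r \<subseteq> {m}"
  proof
    fix c assume "c \<in> cball (m - h) r \<inter> cball (m + h) r"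
    then have "norm ((c - m) + h) \<le> r" "norm ((c - m) - h) \<le> r"
      by (auto simp: dist_norm norm_minus_commute algebra_simps)
    then have "(norm ((c - m) + h))\<^sup>2 \<le> r\<^sup>2" "(norm ((c - m) - h))\<^sup>2 \<le> r\<^sup>2"
      by (simp_all add: power_mono)
    moreover have "(norm ((c - m) + h))\<^sup>2 + (norm ((c - m) - h))\<^sup>2 = 2 * (norm (c - m))\<^sup>2 + 2 * (norm h)\<^sup>2"
      by (simp only: power2_norm_eq_inner) (simp add: inner_add inner_diff inner_commute)
    ultimately have "(norm (c - m))\<^sup>2 \<le> 0" unfolding assms by linarith
    then show "c \<in> {m}" by simp
  qed
next
  show "{m} \<subseteq> cball (m - h) r \<inter> cball (m + h) r"
    using assms by (simp add: dist_norm)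
qed

text \<open>The second condition is nonnegativity of the discriminant of the quadratic in
  \<open>t\<close> obtained by squaring \<open>norm (e - t *\<^sub>R u) = r\<close>; the first puts
  the contact at a positive time and excludes \<open>u = 0\<close>. For a unit vector
  \<open>e\<close> and \<open>0 < r < 1\<close> this is the solid cone around \<open>e\<close> whose
  half-angle has sine \<open>r\<close>, without its apex.\<close>

definition hits :: "'a::real_inner \<Rightarrow> real \<Rightarrow> 'a \<Rightarrow> bool" where
  "hits e r u \<longleftrightarrow> 0 < u \<bullet> e \<and> (1 - r\<^sup>2) * (norm u)\<^sup>2 \<le> (u \<bullet> e)\<^sup>2"

text \<open>The reciprocal of the time at which the ray in direction \<open>u\<close> enters the ball of radius \<open>r\<close>
  around \<open>e\<close>. Unlike the time itself it needs no division by the norm of \<open>u\<close>, and it converges to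
  \<open>u \<bullet> e\<close> for \<open>r \<rightarrow> 0\<close>.\<close>

definition hit_rate :: "'a::real_inner \<Rightarrow> real \<Rightarrow> 'a \<Rightarrow> real" where
  "hit_rate e r u = (u \<bullet> e + sqrt ((u \<bullet> e)\<^sup>2 - (1 - r\<^sup>2) * (norm u)\<^sup>2)) / (1 - r\<^sup>2)"

lemma hit_rate_pos: "hits e r u \<Longrightarrow> \<bar>r\<bar> < 1 \<Longrightarrow> 0 < hit_rate e r u"
  unfolding hits_def hit_rate_def
  by (intro divide_pos_pos add_pos_nonneg) (auto simp: abs_square_less_1)

section \<open>The quadratic inequality for the contact times\<close>

lemma norm_ray_le_iff:
  fixes e u :: "'a::real_inner"
  assumes "norm e = 1" "0 < r"
  shows "norm (e - t *\<^sub>R u) \<le> r \<longleftrightarrow> t\<^sup>2 * (norm u)\<^sup>2 - 2 * t * (u \<bullet> e) + (1 - r\<^sup>2) \<le> 0"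
    and "norm (e - t *\<^sub>R u) = r \<longleftrightarrow> t\<^sup>2 * (norm u)\<^sup>2 - 2 * t * (u \<bullet> e) + (1 - r\<^sup>2) = 0"
proof -
  have *: "(norm (e - t *\<^sub>R u))\<^sup>2 - r\<^sup>2 = t\<^sup>2 * (norm u)\<^sup>2 - 2 * t * (u \<bullet> e) + (1 - r\<^sup>2)"
  proof -
    have "e \<bullet> e = 1" using assms by (simp flip: power2_norm_eq_inner)
    then show ?thesis
      by (simp only: power2_norm_eq_inner)
         (simp add: inner_diff inner_commute power2_eq_square algebra_simps)
  qed
  have "norm (e - t *\<^sub>R u) \<le> r \<longleftrightarrow> (norm (e - t *\<^sub>R u))\<^sup>2 \<le> r\<^sup>2"
    using assms by (metis abs_le_square_iff abs_norm_cancel abs_of_pos)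
  then show "norm (e - t *\<^sub>R u) \<le> r \<longleftrightarrow> t\<^sup>2 * (norm u)\<^sup>2 - 2 * t * (u \<bullet> e) + (1 - r\<^sup>2) \<le> 0"
    using * by linarith
  have "norm (e - t *\<^sub>R u) = r \<longleftrightarrow> (norm (e - t *\<^sub>R u))\<^sup>2 = r\<^sup>2"
    using assms by (metis abs_norm_cancel abs_of_pos power2_eq_iff_nonneg norm_ge_zero less_imp_le)
  then show "norm (e - t *\<^sub>R u) = r \<longleftrightarrow> t\<^sup>2 * (norm u)\<^sup>2 - 2 * t * (u \<bullet> e) + (1 - r\<^sup>2) = 0"
    using * by linarith
qed

text \<open>The constant and the quadratic term cannot produce a value at most 0, so the linear term
  must be negative. Multiplying by \<open>n\<close> before completing the square avoids dividing by
  \<open>n\<close> and yields the discriminant condition.\<close>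

lemma quadratic_root_necessary:
  fixes n a \<rho> t :: real
  assumes "0 \<le> n" "0 < a" "0 \<le> t" "t\<^sup>2 * n - 2 * t * \<rho> + a \<le> 0"
  shows "0 < \<rho>" "a * n \<le> \<rho>\<^sup>2"
proof -
  have "0 \<le> t\<^sup>2 * n" using assms by simp
  then have "0 < t * \<rho>" using assms by linarith
  then show "0 < \<rho>" using assms by (simp add: zero_less_mult_iff)
  have "n * (t\<^sup>2 * n - 2 * t * \<rho> + a) \<le> 0"
    using assms by (simp add: mult_nonneg_nonpos)
  moreover have "(n * t - \<rho>)\<^sup>2 = n * (t\<^sup>2 * n - 2 * t * \<rho> + a) + (\<rho>\<^sup>2 - a * n)"
    by (simp add: power2_eq_square algebra_simps)
  ultimately show "a * n \<le> \<rho>\<^sup>2"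
    using zero_le_power2[of "n * t - \<rho>"] by linarith
qed

text \<open>The root is written in rationalised form, with no division by \<open>n\<close>.
  Accordingly \<open>a\<close> times the quadratic, rather than \<open>n\<close> times it, is split
  into linear factors; at nonnegative times before \<open>\<tau>\<close> both factors are
  positive.\<close>

lemma quadratic_first_root:
  fixes n a \<rho> :: real
  assumes "0 < a" "0 < \<rho>" "a * n \<le> \<rho>\<^sup>2"
  defines "\<tau> \<equiv> a / (\<rho> + sqrt (\<rho>\<^sup>2 - a * n))"
  shows "\<tau>\<^sup>2 * n - 2 * \<tau> * \<rho> + a = 0"
    and "\<And>t. 0 \<le> t \<Longrightarrow> t\<^sup>2 * n - 2 * t * \<rho> + a \<le> 0 \<Longrightarrow> \<tau> \<le> t"
proof -
  define \<delta> where "\<delta> = sqrt (\<rho>\<^sup>2 - a * n)"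
  have \<delta>: "0 \<le> \<delta>" "a * n = \<rho>\<^sup>2 - \<delta>\<^sup>2" using assms by (simp_all add: \<delta>_def)
  have factor: "a * (t\<^sup>2 * n - 2 * t * \<rho> + a) = (a - (\<rho> - \<delta>) * t) * (a - (\<rho> + \<delta>) * t)" for t
  proof -
    have "a * (t\<^sup>2 * n - 2 * t * \<rho> + a) = t\<^sup>2 * (a * n) - 2 * a * t * \<rho> + a\<^sup>2"
      by (simp add: power2_eq_square algebra_simps)
    then show ?thesis by (simp add: \<delta> power2_eq_square algebra_simps)
  qed
  have \<tau>: "(\<rho> + \<delta>) * \<tau> = a"
    using \<delta> assms(2) by (simp add: \<tau>_def flip: \<delta>_def)
  then show "\<tau>\<^sup>2 * n - 2 * \<tau> * \<rho> + a = 0"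
    using factor[of \<tau>] assms(1) by simp
  fix t :: real
  assume t: "0 \<le> t" "t\<^sup>2 * n - 2 * t * \<rho> + a \<le> 0"
  show "\<tau> \<le> t"
  proof (rule ccontr)
    assume "\<not> \<tau> \<le> t"
    then have 1: "(\<rho> + \<delta>) * t < a"
      using \<delta> assms(2) by (subst \<tau>[symmetric]) simp
    have "(\<rho> - \<delta>) * t \<le> (\<rho> + \<delta>) * t" using \<delta> t by (intro mult_right_mono) auto
    then have "0 < (a - (\<rho> - \<delta>) * t) * (a - (\<rho> + \<delta>) * t)" using 1 by simp
    moreover have "a * (t\<^sup>2 * n - 2 * t * \<rho> + a) \<le> 0"
      using t assms(1) by (simp add: mult_nonneg_nonpos)
    ultimately show False using factor[of t] by linarith
  qed
qed

text \<open>At time \<open>t\<close> the two centres are symmetric about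
  \<open>t *\<^sub>R y\<close> with half-difference \<open>e - t *\<^sub>R u\<close>. The common
  velocity \<open>y\<close> therefore moves only the midpoint and drops out of the
  condition.\<close>

lemma moving_cballs_meet_iff:
  fixes e u y :: "'a::real_inner"
  assumes "norm e = 1" "0 < r"
  shows "moving (cball (- e) r) (y + u) t \<inter> moving (cball e r) (y - u) t \<noteq> {} \<longleftrightarrow>
    t\<^sup>2 * (norm u)\<^sup>2 - 2 * t * (u \<bullet> e) + (1 - r\<^sup>2) \<le> 0"
proof -
  have "- e + t *\<^sub>R (y + u) = t *\<^sub>R y - (e - t *\<^sub>R u)" "e + t *\<^sub>R (y - u) = t *\<^sub>R y + (e - t *\<^sub>R u)"
    by (simp_all add: algebra_simps)
  then show ?thesis
    by (simp only: moving_cball cball_Int_cball_nonempty_iff norm_ray_le_iff[OF assms])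
qed

lemma collision_time_cball:
  fixes e u y :: "'a::real_inner"
  assumes "norm e = 1" "0 < r" "r < 1"
  shows "collision_time (cball (- e) r) (cball e r) (y + u) (y - u) =
    (if hits e r u then ereal (1 / hit_rate e r u) else \<infinity>)"
proof -
  let ?q = "\<lambda>t. t\<^sup>2 * (norm u)\<^sup>2 - 2 * t * (u \<bullet> e) + (1 - r\<^sup>2)"
  have a: "0 < 1 - r\<^sup>2" using assms by (simp add: abs_square_less_1)
  show ?thesis
  proof (cases "hits e r u")
    case True
    let ?\<tau> = "(1 - r\<^sup>2) / (u \<bullet> e + sqrt ((u \<bullet> e)\<^sup>2 - (1 - r\<^sup>2) * (norm u)\<^sup>2))"
    have h: "0 < u \<bullet> e" "(1 - r\<^sup>2) * (norm u)\<^sup>2 \<le> (u \<bullet> e)\<^sup>2"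
      using True by (auto simp: hits_def)
    note root = quadratic_first_root[OF a h]
    have \<tau>: "?\<tau> = 1 / hit_rate e r u" by (simp add: hit_rate_def)
    have "0 < 1 / hit_rate e r u" using hit_rate_pos[OF True] assms by simp
    \<comment> \<open>The first root is itself a contact time, so the infimum is attained
      there.\<close>
    then have "Inf (ereal ` {t. 0 \<le> t \<and> ?q t \<le> 0}) = ereal (1 / hit_rate e r u)"
      unfolding \<tau>[symmetric] using root by (intro cInf_eq_minimum) auto
    then show ?thesis
      using True by (simp only: collision_time_def moving_cballs_meet_iff[OF assms(1,2)] if_True)
  next
    case False
    \<comment> \<open>With no contact time the infimum is that of the empty set, which is the top
      element \<open>\<infinity>\<close>.\<close>
    then have "{t. 0 \<le> t \<and> ?q t \<le> 0} = {}"
      using quadratic_root_necessary[OF _ a, of "(norm u)\<^sup>2"] by (force simp: hits_def)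
    then show ?thesis
      using False
      by (simp add: collision_time_def moving_cballs_meet_iff[OF assms(1,2)] top_ereal_def del: Collect_empty_eq)
  qed
qed

text \<open>At the first contact time the quadratic vanishes, so the half-difference of the centres
  has norm exactly \<open>r\<close>. The balls are tangent, and \<open>THE\<close> selects the
  midpoint of the centres.\<close>

lemma collision_location_cball:
  fixes e u y :: "'a::real_inner"
  assumes "norm e = 1" "0 < r" "r < 1" "hits e r u"
  shows "collision_location (cball (- e) r) (cball e r) (y + u) (y - u) = (1 / hit_rate e r u) *\<^sub>R y"
proof -
  let ?\<tau> = "1 / hit_rate e r u"
  have a: "0 < 1 - r\<^sup>2" using assms by (simp add: abs_square_less_1)
  have "?\<tau>\<^sup>2 * (norm u)\<^sup>2 - 2 * ?\<tau> * (u \<bullet> e) + (1 - r\<^sup>2) = 0"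
    using quadratic_first_root(1)[OF a] assms(4) by (simp add: hits_def hit_rate_def)
  then have "norm (e - ?\<tau> *\<^sub>R u) = r" using norm_ray_le_iff(2)[OF assms(1,2)] by blast
  moreover have "- e + ?\<tau> *\<^sub>R (y + u) = ?\<tau> *\<^sub>R y - (e - ?\<tau> *\<^sub>R u)"
    "e + ?\<tau> *\<^sub>R (y - u) = ?\<tau> *\<^sub>R y + (e - ?\<tau> *\<^sub>R u)"
    by (simp_all add: algebra_simps)
  ultimately have "moving (cball (- e) r) (y + u) ?\<tau> \<inter> moving (cball e r) (y - u) ?\<tau> = {?\<tau> *\<^sub>R y}"
    by (simp only: moving_cball cball_Int_cball_tangent)
  then show ?thesis
    using assms by (simp add: collision_location_def collision_time_cball Let_def del: Int_iff)
qed

section \<open>Gaussian integrals and changes of variables\<close>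

lemma power2_norm_eq_sum_Basis: "(norm x)\<^sup>2 = (\<Sum>b\<in>Basis. (x \<bullet> b)\<^sup>2)"
  for x :: "'a::euclidean_space"
  unfolding power2_norm_eq_inner by (subst euclidean_inner) (simp add: power2_eq_square)

text \<open>The integrand factors over the coordinates, which leaves a finite power of a
  one-dimensional Gaussian integral.\<close>

lemma integrable_exp_neg_norm_sq:
  assumes "0 < (c::real)"
  shows "integrable lborel (\<lambda>x::'a::euclidean_space. exp (- c * (norm x)\<^sup>2))"
proof -
  have 1: "(\<integral>\<^sup>+x. ennreal (exp (- c * x\<^sup>2)) \<partial>lborel) < \<infinity>"
  proof -
    \<comment> \<open>Variance \<open>1 / (2 * c)\<close> produces the exponent
      \<open>- c * x\<^sup>2\<close>, and \<open>sqrt (pi / c)\<close> cancels the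
      normalisation.\<close>
    have "integrable lborel (\<lambda>x. sqrt (pi / c) * normal_density 0 (sqrt (1 / (2 * c))) x)"
      using assms by (intro integrable_mult_right integrable_normal_density) auto
    also have "(\<lambda>x. sqrt (pi / c) * normal_density 0 (sqrt (1 / (2 * c))) x) = (\<lambda>x. exp (- c * x\<^sup>2))"
      using assms by (auto simp: normal_density_def fun_eq_iff field_simps)
    finally show ?thesis by (simp add: integrable_iff_bounded)
  qed
  have "(\<integral>\<^sup>+(x::'a). ennreal (exp (- c * (norm x)\<^sup>2)) \<partial>lborel) =
      (\<integral>\<^sup>+(x::'a). (\<Prod>b\<in>Basis. ennreal (exp (- c * (x \<bullet> b)\<^sup>2))) \<partial>lborel)"
    by (simp only: power2_norm_eq_sum_Basis sum_distrib_left exp_sum[OF finite_Basis]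
        prod_ennreal[OF exp_ge_zero])
  also have "\<dots> = (\<Prod>b\<in>(Basis :: 'a set). \<integral>\<^sup>+x. ennreal (exp (- c * x\<^sup>2)) \<partial>lborel)"
    by (subst nn_integral_lborel_prod) auto
  also have "\<dots> < \<infinity>" using 1 by (simp add: power_less_top_ennreal)
  finally show ?thesis by (simp add: integrable_iff_bounded)
qed

section \<open>Linear changes of variables\<close>

lemma nn_integral_lborel_affine:
  fixes f :: "'a::euclidean_space \<Rightarrow> ennreal"
  assumes [measurable]: "f \<in> borel_measurable borel" and c: "c \<noteq> 0"
  shows "(\<integral>\<^sup>+x. f x \<partial>lborel) = ennreal (\<bar>c\<bar> ^ DIM('a)) * (\<integral>\<^sup>+x. f (t + c *\<^sub>R x) \<partial>lborel)"
  by (subst lborel_affine[OF c, of t])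
     (simp add: nn_integral_density nn_integral_distr nn_integral_cmult)

text \<open>For a unit vector \<open>e\<close> this fixes the component along \<open>e\<close> and
  multiplies the orthogonal component by \<open>r\<close>.\<close>

definition squeeze :: "'a::real_inner \<Rightarrow> real \<Rightarrow> 'a \<Rightarrow> 'a" where
  "squeeze e r x = r *\<^sub>R x + ((1 - r) * (x \<bullet> e)) *\<^sub>R e"

lemma squeeze_inner: "norm e = 1 \<Longrightarrow> squeeze e r x \<bullet> e = x \<bullet> e"
  by (simp add: squeeze_def inner_add_left norm_eq_1 algebra_simps)

lemma norm_squeeze_sq:
  assumes "norm e = 1"
  shows "(norm (squeeze e r x))\<^sup>2 = (x \<bullet> e)\<^sup>2 + r\<^sup>2 * ((norm x)\<^sup>2 - (x \<bullet> e)\<^sup>2)"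
proof -
  have "e \<bullet> e = 1" using assms by (simp add: norm_eq_1)
  then show ?thesis
    unfolding squeeze_def power2_norm_eq_inner
    by (simp add: inner_add inner_commute power2_eq_square algebra_simps)
qed

lemma squeeze_measurable[measurable]: "squeeze e r \<in> borel_measurable borel"
  for e :: "'a::euclidean_space"
  unfolding squeeze_def[abs_def] by measurable

text \<open>For \<open>e\<close> in the basis the map is diagonal: the entry at \<open>e\<close> is
  1 and the remaining ones are \<open>r\<close>, hence the Jacobian.\<close>

lemma nn_integral_squeeze:
  fixes f :: "'a::euclidean_space \<Rightarrow> ennreal"
  assumes [measurable]: "f \<in> borel_measurable borel" and e: "e \<in> Basis" and r: "0 < r"
  shows "(\<integral>\<^sup>+x. f x \<partial>lborel) = ennreal (r ^ (DIM('a) - 1)) * (\<integral>\<^sup>+x. f (squeeze e r x) \<partial>lborel)"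
proof -
  let ?c = "\<lambda>j::'a. if j = e then 1 else r"
  have sq: "0 + (\<Sum>j\<in>Basis. (?c j * (x \<bullet> j)) *\<^sub>R j) = squeeze e r x" for x
  proof -
    have "0 + (\<Sum>j\<in>Basis. (?c j * (x \<bullet> j)) *\<^sub>R j) =
        (\<Sum>j\<in>Basis. r *\<^sub>R ((x \<bullet> j) *\<^sub>R j) + (if j = e then ((1 - r) * (x \<bullet> j)) *\<^sub>R j else 0))"
      by (auto intro!: sum.cong simp: algebra_simps)
    also have "\<dots> = r *\<^sub>R (\<Sum>j\<in>Basis. (x \<bullet> j) *\<^sub>R j) + ((1 - r) * (x \<bullet> e)) *\<^sub>R e"
      using e by (simp add: sum.distrib scaleR_sum_right sum.delta)
    finally show ?thesis by (simp add: euclidean_representation squeeze_def)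
  qed
  have prod: "(\<Prod>j\<in>Basis. \<bar>?c j\<bar>) = r ^ (DIM('a) - 1)"
    using r e by (simp add: prod.remove[OF _ e])
  have "lborel = density (distr lborel borel (squeeze e r)) (\<lambda>_. ennreal (r ^ (DIM('a) - 1)))"
    using lborel_affine_euclidean[of ?c 0] r by (simp only: sq prod) (auto split: if_splits)
  then have "(\<integral>\<^sup>+x. f x \<partial>lborel) =
      (\<integral>\<^sup>+x. f x \<partial>density (distr lborel borel (squeeze e r)) (\<lambda>_. ennreal (r ^ (DIM('a) - 1))))"
    by simp
  then show ?thesis
    by (simp add: nn_integral_density nn_integral_distr nn_integral_cmult)
qed

text \<open>The substitution is done in two affine steps: \<open>v = w + 2 *\<^sub>R u\<close> for
  fixed \<open>w\<close>, which accounts for the whole Jacobian, and then, after exchanging the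
  integrals, the translation \<open>w = y - u\<close> for fixed \<open>u\<close>.\<close>

lemma nn_integral_sum_difference:
  fixes f :: "'a::euclidean_space \<Rightarrow> 'a \<Rightarrow> ennreal"
  assumes [measurable]: "(\<lambda>(v, w). f v w) \<in> borel_measurable (borel \<Otimes>\<^sub>M borel)"
  shows "(\<integral>\<^sup>+w. \<integral>\<^sup>+v. f v w \<partial>lborel \<partial>lborel) =
    ennreal (2 ^ DIM('a)) * (\<integral>\<^sup>+u. \<integral>\<^sup>+y. f (y + u) (y - u) \<partial>lborel \<partial>lborel)"
proof -
  have "(\<integral>\<^sup>+w. \<integral>\<^sup>+v. f v w \<partial>lborel \<partial>lborel) =
      (\<integral>\<^sup>+w. ennreal (2 ^ DIM('a)) * (\<integral>\<^sup>+u. f (w + 2 *\<^sub>R u) w \<partial>lborel) \<partial>lborel)"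
    using nn_integral_lborel_affine[of "\<lambda>v. f v _" 2 _] by (intro nn_integral_cong) simp
  also have "\<dots> = ennreal (2 ^ DIM('a)) * (\<integral>\<^sup>+w. \<integral>\<^sup>+u. f (w + 2 *\<^sub>R u) w \<partial>lborel \<partial>lborel)"
    by (intro nn_integral_cmult) simp
  also have "(\<integral>\<^sup>+w. \<integral>\<^sup>+u. f (w + 2 *\<^sub>R u) w \<partial>lborel \<partial>lborel) =
      (\<integral>\<^sup>+u. \<integral>\<^sup>+w. f (w + 2 *\<^sub>R u) w \<partial>lborel \<partial>lborel)"
    by (intro lborel_pair.Fubini') simp
  also have "\<dots> = (\<integral>\<^sup>+u. \<integral>\<^sup>+y. f (y + u) (y - u) \<partial>lborel \<partial>lborel)"
  proof (rule nn_integral_cong)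
    fix u :: 'a
    have "(\<integral>\<^sup>+w. f (w + 2 *\<^sub>R u) w \<partial>lborel) = (\<integral>\<^sup>+y. f ((- u + 1 *\<^sub>R y) + 2 *\<^sub>R u) (- u + 1 *\<^sub>R y) \<partial>lborel)"
      using nn_integral_lborel_affine[of "\<lambda>w. f (w + 2 *\<^sub>R u) w" 1 "- u"] by simp
    also have "\<dots> = (\<integral>\<^sup>+y. f (y + u) (y - u) \<partial>lborel)"
      by (intro nn_integral_cong arg_cong2[of _ _ _ _ f]) (auto simp: scaleR_2)
    finally show "(\<integral>\<^sup>+w. f (w + 2 *\<^sub>R u) w \<partial>lborel) = (\<integral>\<^sup>+y. f (y + u) (y - u) \<partial>lborel)" .
  qed
  finally show ?thesis .
qed

section \<open>Integration over a cone by slices\<close>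

lemma borel_measurable_cone_indicator:
  fixes p q :: "'b \<Rightarrow> real" and h :: "real \<Rightarrow> ennreal"
  assumes [measurable]: "h \<in> borel_measurable borel" "p \<in> borel_measurable M" "q \<in> borel_measurable M"
  shows "(\<lambda>x. indicator {x. 0 < p x \<and> q x \<le> (p x)\<^sup>2} x * h (p x)) \<in> borel_measurable M"
  unfolding indicator_def mem_Collect_eq by measurable

text \<open>The slice of the cone at height \<open>t = u \<bullet> e\<close> is a ball of radius
  \<open>t\<close> in the orthogonal hyperplane. Fubini is applied in coordinates, with the
  coordinate at \<open>e\<close> as the outer variable.\<close>

lemma nn_integral_cone:
  fixes h :: "real \<Rightarrow> ennreal" and e :: "'a::euclidean_space"
  assumes [measurable]: "h \<in> borel_measurable borel" and e: "e \<in> Basis"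
  shows "(\<integral>\<^sup>+u. indicator {u. 0 < u \<bullet> e \<and> (norm u)\<^sup>2 - (u \<bullet> e)\<^sup>2 \<le> (u \<bullet> e)\<^sup>2} u * h (u \<bullet> e) \<partial>lborel) =
    (\<integral>\<^sup>+t. indicator {0<..} t * ennreal (unit_ball_vol (real (DIM('a) - 1)) * t ^ (DIM('a) - 1)) * h t \<partial>lborel)"
proof -
  interpret product_sigma_finite "\<lambda>_::'a. lborel :: real measure" by standard
  let ?I = "Basis - {e} :: 'a set"
  let ?P = "\<lambda>I. \<Pi>\<^sub>M b\<in>I. (lborel :: real measure)"
  have ins: "insert e ?I = Basis" using e by auto
  have norm: "(norm (\<Sum>b\<in>Basis. f b *\<^sub>R b :: 'a))\<^sup>2 = (f e)\<^sup>2 + (\<Sum>b\<in>?I. (f b)\<^sup>2)" for f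
  proof -
    have "(norm (\<Sum>b\<in>Basis. f b *\<^sub>R b :: 'a))\<^sup>2 = (\<Sum>b\<in>Basis. (f b)\<^sup>2)"
      unfolding power2_norm_eq_sum_Basis by (intro sum.cong) auto
    then show ?thesis using e by (simp add: sum.remove)
  qed
  let ?F = "\<lambda>f::'a \<Rightarrow> real. indicator {f. 0 < f e \<and> (\<Sum>b\<in>?I. (f b)\<^sup>2) \<le> (f e)\<^sup>2} f * h (f e)"
  have F: "?F \<in> borel_measurable (?P (insert e ?I))"
  proof -
    have comp: "(\<lambda>f. f b) \<in> borel_measurable (?P (insert e ?I))" if "b \<in> insert e ?I" for b
      using measurable_component_singleton[OF that, of "\<lambda>_. lborel :: real measure"] by simp
    show ?thesis by (intro borel_measurable_cone_indicator borel_measurable_sum borel_measurable_power comp assms(1)) auto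
  qed
  have "(\<integral>\<^sup>+u. indicator {u. 0 < u \<bullet> e \<and> (norm u)\<^sup>2 - (u \<bullet> e)\<^sup>2 \<le> (u \<bullet> e)\<^sup>2} u * h (u \<bullet> e) \<partial>lborel) =
      (\<integral>\<^sup>+f. ?F f \<partial>?P Basis)"
    using e by (subst lborel_eq, subst nn_integral_distr) (simp_all add: norm indicator_def)
  also have "\<dots> = (\<integral>\<^sup>+f. ?F f \<partial>?P (insert e ?I))" by (simp only: ins)
  also have "\<dots> = (\<integral>\<^sup>+t. \<integral>\<^sup>+f. ?F (f(e := t)) \<partial>?P ?I \<partial>lborel)"
    by (rule product_nn_integral_insert_rev[OF _ _ F]) auto
  also have "\<dots> = (\<integral>\<^sup>+t. indicator {0<..} t * ennreal (unit_ball_vol (real (DIM('a) - 1)) * t ^ (DIM('a) - 1)) * h t \<partial>lborel)"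
  proof (intro nn_integral_cong)
    fix t :: real
    show "(\<integral>\<^sup>+f. ?F (f(e := t)) \<partial>?P ?I) =
      indicator {0<..} t * ennreal (unit_ball_vol (real (DIM('a) - 1)) * t ^ (DIM('a) - 1)) * h t"
    proof (cases "0 < t")
      case True
      let ?B = "{f. sqrt (\<Sum>b\<in>?I. (f b)\<^sup>2) \<le> t} \<inter> space (?P ?I)"
      have "(\<integral>\<^sup>+f. ?F (f(e := t)) \<partial>?P ?I) = (\<integral>\<^sup>+f. h t * indicator ?B f \<partial>?P ?I)"
        using True
        by (intro nn_integral_cong) (auto simp: indicator_def real_sqrt_le_iff' sum_nonneg)
      also have "\<dots> = h t * emeasure (?P ?I) ?B"
        by (intro nn_integral_cmult_indicator) measurable
      \<comment> \<open>\<open>?I\<close> has one element fewer than the basis, so this is the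
        volume of a ball in one dimension less.\<close>
      also have "emeasure (?P ?I) ?B = ennreal (unit_ball_vol (real (DIM('a) - 1)) * t ^ (DIM('a) - 1))"
        using emeasure_cball_aux[of ?I t] True e by simp
      also have "h t * \<dots> = indicator {0<..} t * \<dots> * h t" using True by (simp add: mult.commute)
      finally show ?thesis .
    qed simp
  qed
  finally show ?thesis .
qed

text \<open>Rescaling \<open>t\<close> by \<open>sqrt a\<close> reduces this to the known moment
  \<open>fact k / 2\<close> for \<open>a = 1\<close>.\<close>

lemma nn_integral_gaussian_odd_moment:
  fixes a :: real
  assumes a: "0 < a"
  shows "(\<integral>\<^sup>+t. indicator {0<..} t * ennreal (t ^ (2 * k + 1) * exp (- a * t\<^sup>2)) \<partial>lborel) =
    ennreal (fact k / (2 * a ^ (k + 1)))"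
proof -
  let ?f = "\<lambda>t::real. ennreal (indicator {0..} t *\<^sub>R (exp (- t\<^sup>2) * t ^ (2 * k + 1)))"
  have "ennreal (fact k / 2) = (\<integral>\<^sup>+t. ?f t \<partial>lborel)"
    using gaussian_moment_odd_pos[of k]
    by (subst nn_integral_eq_integral) (auto simp: has_bochner_integral_iff indicator_def)
  also have "\<dots> = ennreal (sqrt a) * (\<integral>\<^sup>+t. ?f (0 + sqrt a * t) \<partial>lborel)"
    using a by (subst nn_integral_real_affine[where c="sqrt a" and t=0]) auto
  finally have 1: "ennreal (fact k / 2) = ennreal (sqrt a) * (\<integral>\<^sup>+t. ?f (0 + sqrt a * t) \<partial>lborel)" .
  have "(\<integral>\<^sup>+t. indicator {0<..} t * ennreal (t ^ (2 * k + 1) * exp (- a * t\<^sup>2)) \<partial>lborel) =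
    (\<integral>\<^sup>+t. ennreal (1 / sqrt a ^ (2 * k + 1)) * ?f (0 + sqrt a * t) \<partial>lborel)"
    using a by (intro nn_integral_cong)
      (auto simp: indicator_def ennreal_mult'[symmetric] power_mult_distrib zero_le_mult_iff field_simps)
  also have "\<dots> = ennreal (1 / sqrt a ^ (2 * k + 1)) * (\<integral>\<^sup>+t. ?f (0 + sqrt a * t) \<partial>lborel)"
    by (intro nn_integral_cmult) simp
  \<comment> \<open>One factor \<open>sqrt a\<close> is split off to match the Jacobian in fact
    \<open>1\<close>.\<close>
  also have "ennreal (1 / sqrt a ^ (2 * k + 1)) = ennreal (1 / sqrt a ^ (2 * k + 2)) * ennreal (sqrt a)"
    using a by (simp flip: ennreal_mult')
  also have "\<dots> * (\<integral>\<^sup>+t. ?f (0 + sqrt a * t) \<partial>lborel) = ennreal (1 / sqrt a ^ (2 * k + 2)) * ennreal (fact k / 2)"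
    by (simp only: 1 mult.assoc)
  also have "sqrt a ^ (2 * k + 2) = a ^ (k + 1)"
    using a by (simp add: power_add power_mult power2_eq_square)
  also have "ennreal (1 / a ^ (k + 1)) * ennreal (fact k / 2) = ennreal (fact k / (2 * a ^ (k + 1)))"
    using a by (subst ennreal_mult'[symmetric]) (auto simp: mult.commute)
  finally show ?thesis .
qed

section \<open>The limit of the rescaled integral\<close>

text \<open>For \<open>Y\<close> of law \<open>N(0, I / 2)\<close> this is \<open>pi ^ (d / 2)\<close> times the probability of \<open>Y / s \<in> A\<close>.\<close>

definition gauss_scaled :: "'a::euclidean_space set \<Rightarrow> real \<Rightarrow> real" where
  "gauss_scaled A s = (\<integral>x. indicator A ((1 / s) *\<^sub>R x) * exp (- (norm x)\<^sup>2) \<partial>lborel)"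

context
  fixes A :: "'a::euclidean_space set"
  assumes A[measurable]: "A \<in> sets borel"
begin

lemma integrable_gauss_scaled:
  "integrable lborel (\<lambda>x. indicator A (c *\<^sub>R x) * exp (- (norm x)\<^sup>2))"
  using integrable_exp_neg_norm_sq[of 1, where 'a='a]
  by (rule Bochner_Integration.integrable_bound) (auto simp: indicator_def)

lemma gauss_scaled_nonneg: "0 \<le> gauss_scaled A s"
  unfolding gauss_scaled_def by (intro integral_nonneg_AE) auto

lemma gauss_scaled_le: "gauss_scaled A s \<le> (\<integral>(x::'a). exp (- (norm x)\<^sup>2) \<partial>lborel)"
  unfolding gauss_scaled_def using integrable_exp_neg_norm_sq[of 1, where 'a='a]
  by (intro integral_mono integrable_gauss_scaled) (auto simp: indicator_def)

lemma borel_measurable_gauss_scaled[measurable]: "gauss_scaled A \<in> borel_measurable borel"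
  unfolding gauss_scaled_def[abs_def] by measurable

lemma ennreal_gauss_scaled:
  "ennreal (gauss_scaled A s) = (\<integral>\<^sup>+x. indicator A ((1 / s) *\<^sub>R x) * ennreal (exp (- (norm x)\<^sup>2)) \<partial>lborel)"
  unfolding gauss_scaled_def
  by (subst nn_integral_eq_integral[OF integrable_gauss_scaled, symmetric])
     (auto simp: indicator_def intro!: nn_integral_cong)

text \<open>Scaling the variable by \<open>s\<close> moves the parameter out of the indicator into a
  smooth density. Both continuity in \<open>s\<close> and the later exchange of integrals rely on
  this form.\<close>

lemma ennreal_gauss_scaled_density:
  assumes s: "0 < s"
  shows "ennreal (gauss_scaled A s) =
    (\<integral>\<^sup>+x. indicator A x * ennreal (s ^ DIM('a) * exp (- s\<^sup>2 * (norm x)\<^sup>2)) \<partial>lborel)"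
proof -
  have "ennreal (gauss_scaled A s) = ennreal (s ^ DIM('a)) *
      (\<integral>\<^sup>+x. indicator A ((1 / s) *\<^sub>R (0 + s *\<^sub>R x)) * ennreal (exp (- (norm (0 + s *\<^sub>R x))\<^sup>2)) \<partial>lborel)"
    using s unfolding ennreal_gauss_scaled
    by (subst nn_integral_lborel_affine[of _ s 0]) auto
  also have "\<dots> = (\<integral>\<^sup>+x. ennreal (s ^ DIM('a)) *
      (indicator A ((1 / s) *\<^sub>R (0 + s *\<^sub>R x)) * ennreal (exp (- (norm (0 + s *\<^sub>R x))\<^sup>2))) \<partial>lborel)"
    by (rule nn_integral_cmult[symmetric]) measurable
  also have "\<dots> = (\<integral>\<^sup>+x. indicator A x * ennreal (s ^ DIM('a) * exp (- s\<^sup>2 * (norm x)\<^sup>2)) \<partial>lborel)"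
    using s by (intro nn_integral_cong) (auto simp: indicator_def ennreal_mult' power_mult_distrib)
  finally show ?thesis .
qed

lemma gauss_scaled_density:
  assumes s: "0 < s"
  shows "gauss_scaled A s = (\<integral>x. indicator A x * (s ^ DIM('a) * exp (- s\<^sup>2 * (norm x)\<^sup>2)) \<partial>lborel)"
proof -
  have "gauss_scaled A s = enn2real (ennreal (gauss_scaled A s))"
    by (simp add: gauss_scaled_nonneg)
  also have "\<dots> = (\<integral>x. indicator A x * (s ^ DIM('a) * exp (- s\<^sup>2 * (norm x)\<^sup>2)) \<partial>lborel)"
    unfolding ennreal_gauss_scaled_density[OF s]
    using s by (intro enn2real_nn_integral_eq_integral) (auto simp: indicator_def)
  finally show ?thesis .
qed

text \<open>Dominated convergence along sequences: a convergent sequence of parameters is bounded by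
  some \<open>K\<close>, and the bounded set \<open>A\<close> has finite measure, so a constant on
  \<open>A\<close> is an integrable majorant.\<close>

lemma isCont_gauss_scaled:
  assumes "bounded A" and s: "0 < s"
  shows "isCont (gauss_scaled A) s"
proof -
  let ?f = "\<lambda>s x. indicator A x * (s ^ DIM('a) * exp (- s\<^sup>2 * (norm x)\<^sup>2))"
  have "isCont (\<lambda>s. \<integral>x. ?f s x \<partial>lborel) s"
    unfolding continuous_at_sequentially comp_def
  proof safe
    fix X assume X: "X \<longlonglongrightarrow> s"
    then obtain K where K: "\<And>n. \<bar>X n\<bar> \<le> K"
      by (metis Bseq_def convergentI convergent_imp_Bseq real_norm_def)
    have fin: "emeasure lborel A < \<infinity>" using assms(1) by (rule emeasure_bounded_finite)
    show "(\<lambda>n. \<integral>x. ?f (X n) x \<partial>lborel) \<longlonglongrightarrow> (\<integral>x. ?f s x \<partial>lborel)"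
    proof (rule integral_dominated_convergence[where w="\<lambda>x. indicator A x * K ^ DIM('a)"])
      show "integrable lborel (\<lambda>x. indicator A x * K ^ DIM('a))"
        using fin by (intro integrable_mult_left integrable_real_indicator) auto
      show "AE x in lborel. (\<lambda>n. ?f (X n) x) \<longlonglongrightarrow> ?f s x"
        using X by (intro AE_I2 tendsto_intros)
      fix n
      have "\<bar>X n\<bar> ^ DIM('a) * exp (- (X n)\<^sup>2 * (norm x)\<^sup>2) \<le> K ^ DIM('a) * 1" for x :: 'a
        using K[of n] by (intro mult_mono power_mono) auto
      then show "AE x in lborel. norm (?f (X n) x) \<le> indicator A x * K ^ DIM('a)"
        by (intro AE_I2) (auto simp: abs_mult power_abs indicator_def)
    qed measurable
  qed
  \<comment> \<open>The density form is available for positive parameters only, so the two functions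
    are compared near \<open>s\<close>.\<close>
  moreover have "eventually (\<lambda>s. gauss_scaled A s = (\<integral>x. ?f s x \<partial>lborel)) (nhds s)"
    using eventually_nhds_in_open[of "{0<..}" s] s
    by (auto elim!: eventually_mono simp: gauss_scaled_density)
  ultimately show ?thesis by (subst isCont_cong)
qed

end

text \<open>For independent \<open>u\<close> and \<open>y\<close> of law \<open>N(0, I / 2)\<close>,
  this is the density in \<open>u\<close> of the event that \<open>u\<close> hits and the contact
  point lies in \<open>A\<close>. Half of the power of \<open>pi\<close> normalises the law of
  \<open>u\<close>, the other half turns \<open>gauss_scaled\<close> into a probability.\<close>

definition hit_density :: "'a::euclidean_space \<Rightarrow> 'a set \<Rightarrow> real \<Rightarrow> 'a \<Rightarrow> real" where
  "hit_density e A r u =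
    indicator {u. hits e r u} u * (exp (- (norm u)\<^sup>2) * gauss_scaled A (hit_rate e r u) / pi ^ DIM('a))"

definition hit_density_limit :: "'a::euclidean_space \<Rightarrow> 'a set \<Rightarrow> 'a \<Rightarrow> real" where
  "hit_density_limit e A u =
    indicator {u. 0 < u \<bullet> e \<and> (norm u)\<^sup>2 - (u \<bullet> e)\<^sup>2 \<le> (u \<bullet> e)\<^sup>2} u *
      (exp (- (u \<bullet> e)\<^sup>2) * gauss_scaled A (u \<bullet> e) / pi ^ DIM('a))"

section \<open>Convergence of the squeezed densities\<close>

lemma hits_measurable[measurable]: "Measurable.pred borel (hits e r)"
  for e :: "'a::euclidean_space"
  unfolding hits_def[abs_def] by measurable

lemma hit_rate_measurable[measurable]: "hit_rate e r \<in> borel_measurable borel"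
  for e :: "'a::euclidean_space"
  unfolding hit_rate_def[abs_def] by measurable

lemma hit_density_measurable[measurable]:
  assumes [measurable]: "A \<in> sets borel"
  shows "hit_density e A r \<in> borel_measurable borel"
  unfolding hit_density_def[abs_def] indicator_def mem_Collect_eq by measurable

lemma hit_density_limit_measurable[measurable]:
  assumes [measurable]: "A \<in> sets borel"
  shows "hit_density_limit e A \<in> borel_measurable borel"
  unfolding hit_density_limit_def[abs_def] indicator_def mem_Collect_eq by measurable

text \<open>After squeezing, the terms in \<open>(u \<bullet> e)\<^sup>2\<close> cancel up to a
  multiple of \<open>r\<^sup>2\<close>. Dividing by \<open>r\<^sup>2\<close> leaves a cone that no
  longer degenerates as \<open>r\<close> tends to 0.\<close>

lemma hits_squeeze:
  assumes "norm e = 1" "0 < r"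
  shows "hits e r (squeeze e r u) \<longleftrightarrow> 0 < u \<bullet> e \<and> (1 - r\<^sup>2) * ((norm u)\<^sup>2 - (u \<bullet> e)\<^sup>2) \<le> (u \<bullet> e)\<^sup>2"
proof -
  have "(1 - r\<^sup>2) * ((u \<bullet> e)\<^sup>2 + r\<^sup>2 * ((norm u)\<^sup>2 - (u \<bullet> e)\<^sup>2)) \<le> (u \<bullet> e)\<^sup>2 \<longleftrightarrow>
      r\<^sup>2 * ((1 - r\<^sup>2) * ((norm u)\<^sup>2 - (u \<bullet> e)\<^sup>2)) \<le> r\<^sup>2 * (u \<bullet> e)\<^sup>2"
    by (simp add: algebra_simps)
  also have "\<dots> \<longleftrightarrow> (1 - r\<^sup>2) * ((norm u)\<^sup>2 - (u \<bullet> e)\<^sup>2) \<le> (u \<bullet> e)\<^sup>2"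
    using assms by simp
  finally show ?thesis
    using assms by (simp add: hits_def squeeze_inner norm_squeeze_sq)
qed

text \<open>For \<open>r < 1 / 2\<close> a hitting direction has an orthogonal part, before squeezing, of norm at most
  \<open>2 (u \<bullet> e)\<close>, so the factor \<open>exp (- (u \<bullet> e)\<^sup>2)\<close> also controls the orthogonal directions.\<close>

lemma hit_density_squeeze_bound:
  fixes e :: "'a::euclidean_space"
  assumes A: "A \<in> sets borel" and e: "norm e = 1" and r: "0 < r" "r < 1 / 2"
  shows "norm (hit_density e A r (squeeze e r u)) \<le>
    (\<integral>(x::'a). exp (- (norm x)\<^sup>2) \<partial>lborel) / pi ^ DIM('a) * exp (- (1 / 5) * (norm u)\<^sup>2)"
proof (cases "hits e r (squeeze e r u)")
  case True
  let ?K = "\<integral>(x::'a). exp (- (norm x)\<^sup>2) \<partial>lborel"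
  let ?z = "(norm u)\<^sup>2 - (u \<bullet> e)\<^sup>2"
  have z: "0 \<le> ?z"
    using Cauchy_Schwarz_ineq[of u e] e by (simp add: norm_eq_1 power2_norm_eq_inner)
  have "r\<^sup>2 \<le> (1 / 2)\<^sup>2" using r by (intro power_mono) auto
  then have "(1 / 4) * ?z \<le> (1 - r\<^sup>2) * ?z"
    using z by (intro mult_right_mono) (auto simp: power2_eq_square)
  also have "\<dots> \<le> (u \<bullet> e)\<^sup>2" using True hits_squeeze[OF e r(1)] by auto
  \<comment> \<open>The norm satisfies
    \<open>(norm u)\<^sup>2 = (u \<bullet> e)\<^sup>2 + ?z\<close>, and \<open>?z\<close> is at most
    \<open>4 * (u \<bullet> e)\<^sup>2\<close>; hence the constant 5.\<close>
  finally have "(1 / 5) * (norm u)\<^sup>2 \<le> (u \<bullet> e)\<^sup>2" by simp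
  also have "\<dots> \<le> (norm (squeeze e r u))\<^sup>2" using z by (simp add: norm_squeeze_sq[OF e])
  finally have "exp (- (norm (squeeze e r u))\<^sup>2) \<le> exp (- (1 / 5) * (norm u)\<^sup>2)" by simp
  then have "exp (- (norm (squeeze e r u))\<^sup>2) * gauss_scaled A (hit_rate e r (squeeze e r u)) \<le>
      exp (- (1 / 5) * (norm u)\<^sup>2) * ?K"
    by (intro mult_mono gauss_scaled_le gauss_scaled_nonneg A) auto
  then have "exp (- (norm (squeeze e r u))\<^sup>2) * gauss_scaled A (hit_rate e r (squeeze e r u)) / pi ^ DIM('a) \<le>
      exp (- (1 / 5) * (norm u)\<^sup>2) * ?K / pi ^ DIM('a)"
    by (intro divide_right_mono) auto
  then show ?thesis
    using True by (simp add: hit_density_def abs_mult gauss_scaled_nonneg[OF A] mult.commute)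
next
  case False
  have "0 \<le> (\<integral>(x::'a). exp (- (norm x)\<^sup>2) \<partial>lborel)" by (intro integral_nonneg_AE) auto
  then show ?thesis using False by (simp add: hit_density_def)
qed

text \<open>Off the limiting cone both sides eventually vanish; on it the exponential and the hit
  rate converge and \<open>gauss_scaled\<close> is continuous. The boundary is included, so
  convergence holds at every \<open>u\<close>.\<close>

lemma tendsto_hit_density_squeeze:
  fixes e :: "'a::euclidean_space"
  assumes A: "A \<in> sets borel" "bounded A" and e: "norm e = 1"
  shows "((\<lambda>r. hit_density e A r (squeeze e r u)) \<longlongrightarrow> hit_density_limit e A u) (at_right 0)"
proof -
  let ?z = "(norm u)\<^sup>2 - (u \<bullet> e)\<^sup>2"
  have ev: "\<forall>\<^sub>F r in at_right 0. 0 < r \<and> r < (1::real)"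
    by (simp add: eventually_at_right_field) (metis zero_less_one)
  have z: "0 \<le> ?z"
    using Cauchy_Schwarz_ineq[of u e] e by (simp add: norm_eq_1 power2_norm_eq_inner)
  have r0: "((\<lambda>r::real. r) \<longlongrightarrow> 0) (at_right 0)" by (rule tendsto_ident_at)
  consider "u \<bullet> e \<le> 0" | "(u \<bullet> e)\<^sup>2 < ?z" | "0 < u \<bullet> e" "?z \<le> (u \<bullet> e)\<^sup>2" by linarith
  then show ?thesis
  proof cases
    case 1
    have "\<forall>\<^sub>F r in at_right 0. hit_density e A r (squeeze e r u) = hit_density_limit e A u"
      using ev by eventually_elim (use 1 in \<open>simp add: hit_density_def hit_density_limit_def hits_squeeze[OF e]\<close>)
    then show ?thesis by (rule tendsto_eventually)
  next
    case 2
    have "((\<lambda>r. (1 - r\<^sup>2) * ?z) \<longlongrightarrow> (1 - 0\<^sup>2) * ?z) (at_right 0)"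
      by (intro tendsto_intros r0)
    then have "\<forall>\<^sub>F r in at_right 0. (u \<bullet> e)\<^sup>2 < (1 - r\<^sup>2) * ?z"
      using 2 by (intro order_tendstoD(1)) auto
    then have "\<forall>\<^sub>F r in at_right 0. hit_density e A r (squeeze e r u) = hit_density_limit e A u"
      using ev by eventually_elim
        (use 2 in \<open>simp add: hit_density_def hit_density_limit_def hits_squeeze[OF e]\<close>)
    then show ?thesis by (rule tendsto_eventually)
  next
    case 3
    have "((\<lambda>r. (u \<bullet> e)\<^sup>2 + r\<^sup>2 * ?z) \<longlongrightarrow> (u \<bullet> e)\<^sup>2 + 0\<^sup>2 * ?z) (at_right 0)"
      by (intro tendsto_intros r0)
    then have n: "((\<lambda>r. (norm (squeeze e r u))\<^sup>2) \<longlongrightarrow> (u \<bullet> e)\<^sup>2) (at_right 0)"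
      by (simp add: norm_squeeze_sq[OF e])
    \<comment> \<open>The square root tends to 0 because the squeezed vector becomes parallel to
      \<open>e\<close>.\<close>
    have "((\<lambda>r. hit_rate e r (squeeze e r u)) \<longlongrightarrow>
        (u \<bullet> e + sqrt ((u \<bullet> e)\<^sup>2 - (1 - 0\<^sup>2) * (u \<bullet> e)\<^sup>2)) / (1 - 0\<^sup>2)) (at_right 0)"
      unfolding hit_rate_def squeeze_inner[OF e] by (intro tendsto_intros n r0) auto
    then have "((\<lambda>r. hit_rate e r (squeeze e r u)) \<longlongrightarrow> u \<bullet> e) (at_right 0)" by simp
    with isCont_gauss_scaled[OF A 3(1)]
    have g: "((\<lambda>r. gauss_scaled A (hit_rate e r (squeeze e r u))) \<longlongrightarrow> gauss_scaled A (u \<bullet> e)) (at_right 0)"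
      by (rule isCont_tendsto_compose)
    have "((\<lambda>r. exp (- (norm (squeeze e r u))\<^sup>2) * gauss_scaled A (hit_rate e r (squeeze e r u)) / pi ^ DIM('a))
        \<longlongrightarrow> exp (- (u \<bullet> e)\<^sup>2) * gauss_scaled A (u \<bullet> e) / pi ^ DIM('a)) (at_right 0)"
      by (intro tendsto_intros n g) auto
    moreover have "hit_density_limit e A u = exp (- (u \<bullet> e)\<^sup>2) * gauss_scaled A (u \<bullet> e) / pi ^ DIM('a)"
      using 3 by (simp add: hit_density_limit_def)
    moreover have "\<forall>\<^sub>F r in at_right 0. hit_density e A r (squeeze e r u) =
      exp (- (norm (squeeze e r u))\<^sup>2) * gauss_scaled A (hit_rate e r (squeeze e r u)) / pi ^ DIM('a)"
      using ev
    proof eventually_elim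
      case (elim r)
      \<comment> \<open>The squeezed cones contain the closed limiting cone, so boundary points hit
        as well.\<close>
      have "(1 - r\<^sup>2) * ?z \<le> 1 * ?z" using z by (intro mult_right_mono) auto
      then have "hits e r (squeeze e r u)" using 3 elim hits_squeeze[OF e] by auto
      then show ?case by (simp add: hit_density_def)
    qed
    ultimately show ?thesis by (simp add: filterlim_cong)
  qed
qed

text \<open>The Gaussian majorant does not depend on \<open>r\<close> as long as
  \<open>r < 1 / 2\<close>, so sequences below \<open>1 / 2\<close> are used.\<close>

lemma tendsto_integral_hit_density_squeeze:
  fixes e :: "'a::euclidean_space"
  assumes A[measurable]: "A \<in> sets borel" and "bounded A" and e: "norm e = 1"
  shows "((\<lambda>r. \<integral>u. hit_density e A r (squeeze e r u) \<partial>lborel) \<longlongrightarrow>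
    (\<integral>u. hit_density_limit e A u \<partial>lborel)) (at_right 0)"
proof (rule tendsto_at_right_sequentially[of 0 "1 / 2"])
  fix S :: "nat \<Rightarrow> real"
  assume S: "\<And>n. 0 < S n" "\<And>n. S n < 1 / 2" "S \<longlonglongrightarrow> 0"
  have lim: "filterlim S (at_right 0) sequentially"
    using S by (intro tendsto_imp_filterlim_at_right) auto
  show "(\<lambda>n. \<integral>u. hit_density e A (S n) (squeeze e (S n) u) \<partial>lborel) \<longlonglongrightarrow>
      (\<integral>u. hit_density_limit e A u \<partial>lborel)"
  proof (rule integral_dominated_convergence)
    show "integrable lborel (\<lambda>u. (\<integral>(x::'a). exp (- (norm x)\<^sup>2) \<partial>lborel) / pi ^ DIM('a) *
        exp (- (1 / 5) * (norm u)\<^sup>2))"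
      by (intro integrable_mult_right integrable_exp_neg_norm_sq) simp
    show "AE u in lborel. (\<lambda>n. hit_density e A (S n) (squeeze e (S n) u)) \<longlonglongrightarrow> hit_density_limit e A u"
      using filterlim_compose[OF tendsto_hit_density_squeeze[OF assms] lim] by simp
    show "AE u in lborel. norm (hit_density e A (S n) (squeeze e (S n) u)) \<le>
        (\<integral>(x::'a). exp (- (norm x)\<^sup>2) \<partial>lborel) / pi ^ DIM('a) * exp (- (1 / 5) * (norm u)\<^sup>2)" for n
      using S by (intro AE_I2 hit_density_squeeze_bound A e)
  qed measurable
qed simp

text \<open>Slicing the cone leaves an integral over \<open>t\<close>. With
  \<open>gauss_scaled\<close> in density form and the integrals exchanged, each \<open>x\<close>
  contributes a Gaussian odd moment with parameter \<open>1 + (norm x)\<^sup>2\<close>.\<close>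

lemma integral_hit_density_limit:
  fixes e :: "'a::euclidean_space"
  assumes A[measurable]: "A \<in> sets borel" and e: "e \<in> Basis"
  shows "(\<integral>u. hit_density_limit e A u \<partial>lborel) =
    unit_ball_vol (real (DIM('a) - 1)) * fact (DIM('a) - 1) / (2 * pi ^ DIM('a)) *
    (LINT x:A|lborel. 1 / (1 + (norm x)\<^sup>2) ^ DIM('a))"
proof -
  \<comment> \<open>Here \<open>d\<close> is the dimension minus one: the slice contributes
    \<open>t ^ d\<close>, \<open>gauss_scaled\<close> contributes
    \<open>t ^ (d + 1)\<close>.\<close>
  define d where "d = DIM('a) - 1"
  have d: "DIM('a) = d + 1" by (simp add: d_def)
  define V where "V = unit_ball_vol (real d)"
  have V: "0 \<le> V" by (simp add: V_def)
  have "(\<integral>\<^sup>+u. ennreal (hit_density_limit e A u) \<partial>lborel) =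
      (\<integral>\<^sup>+u. indicator {u. 0 < u \<bullet> e \<and> (norm u)\<^sup>2 - (u \<bullet> e)\<^sup>2 \<le> (u \<bullet> e)\<^sup>2} u *
        ennreal (exp (- (u \<bullet> e)\<^sup>2) * gauss_scaled A (u \<bullet> e) / pi ^ DIM('a)) \<partial>lborel)"
    by (intro nn_integral_cong) (simp add: hit_density_limit_def indicator_def)
  also have "\<dots> = (\<integral>\<^sup>+t. indicator {0<..} t * ennreal (V * t ^ d) *
        ennreal (exp (- t\<^sup>2) * gauss_scaled A t / pi ^ DIM('a)) \<partial>lborel)"
    unfolding V_def d_def
    by (rule nn_integral_cone[OF _ e, of "\<lambda>t. ennreal (exp (- t\<^sup>2) * gauss_scaled A t / pi ^ DIM('a))"]) measurable
  also have "\<dots> = (\<integral>\<^sup>+t. \<integral>\<^sup>+x. indicator A x * ennreal (V / pi ^ DIM('a)) *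
      (indicator {0<..} t * ennreal (t ^ (2 * d + 1) * exp (- (1 + (norm x)\<^sup>2) * t\<^sup>2))) \<partial>lborel \<partial>lborel)"
  proof (rule nn_integral_cong)
    fix t :: real
    show "indicator {0<..} t * ennreal (V * t ^ d) * ennreal (exp (- t\<^sup>2) * gauss_scaled A t / pi ^ DIM('a)) =
      (\<integral>\<^sup>+x. indicator A x * ennreal (V / pi ^ DIM('a)) *
        (indicator {0<..} t * ennreal (t ^ (2 * d + 1) * exp (- (1 + (norm x)\<^sup>2) * t\<^sup>2))) \<partial>lborel)"
    proof (cases "0 < t")
      case True
      have "ennreal (V * t ^ d) * ennreal (exp (- t\<^sup>2) * gauss_scaled A t / pi ^ DIM('a)) =
          ennreal (V * t ^ d * exp (- t\<^sup>2) / pi ^ DIM('a)) * ennreal (gauss_scaled A t)"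
        using True V gauss_scaled_nonneg[OF A]
        by (simp add: mult_ac flip: ennreal_mult)
      also have "\<dots> = (\<integral>\<^sup>+x. ennreal (V * t ^ d * exp (- t\<^sup>2) / pi ^ DIM('a)) *
          (indicator A x * ennreal (t ^ DIM('a) * exp (- t\<^sup>2 * (norm x)\<^sup>2))) \<partial>lborel)"
        unfolding ennreal_gauss_scaled_density[OF A True]
        by (rule nn_integral_cmult[symmetric]) measurable
      also have "\<dots> = (\<integral>\<^sup>+x. indicator A x * ennreal (V / pi ^ DIM('a)) *
        (indicator {0<..} t * ennreal (t ^ (2 * d + 1) * exp (- (1 + (norm x)\<^sup>2) * t\<^sup>2))) \<partial>lborel)"
      proof (rule nn_integral_cong)
        fix x :: 'a
        have "V * t ^ d * exp (- t\<^sup>2) / pi ^ DIM('a) * (t ^ DIM('a) * exp (- t\<^sup>2 * (norm x)\<^sup>2)) =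
            V / pi ^ DIM('a) * (t ^ (2 * d + 1) * exp (- (1 + (norm x)\<^sup>2) * t\<^sup>2))"
        proof -
          have "exp (- (1 + (norm x)\<^sup>2) * t\<^sup>2) = exp (- t\<^sup>2) * exp (- t\<^sup>2 * (norm x)\<^sup>2)"
            by (simp add: algebra_simps flip: exp_add)
          moreover have "t ^ (2 * d + 1) = t ^ d * t ^ DIM('a)" by (simp add: d mult_2 power_add)
          ultimately show ?thesis by simp
        qed
        then show "ennreal (V * t ^ d * exp (- t\<^sup>2) / pi ^ DIM('a)) *
            (indicator A x * ennreal (t ^ DIM('a) * exp (- t\<^sup>2 * (norm x)\<^sup>2))) =
          indicator A x * ennreal (V / pi ^ DIM('a)) *
            (indicator {0<..} t * ennreal (t ^ (2 * d + 1) * exp (- (1 + (norm x)\<^sup>2) * t\<^sup>2)))"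
          using True V by (auto simp: indicator_def simp flip: ennreal_mult)
      qed
      finally show ?thesis using True by simp
    qed simp
  qed
  also have "\<dots> = (\<integral>\<^sup>+x. \<integral>\<^sup>+t. indicator A x * ennreal (V / pi ^ DIM('a)) *
      (indicator {0<..} t * ennreal (t ^ (2 * d + 1) * exp (- (1 + (norm x)\<^sup>2) * t\<^sup>2))) \<partial>lborel \<partial>lborel)"
    by (intro lborel_pair.Fubini') measurable
  also have "\<dots> = (\<integral>\<^sup>+x. indicator A x * ennreal (V / pi ^ DIM('a)) *
      (\<integral>\<^sup>+t. indicator {0<..} t * ennreal (t ^ (2 * d + 1) * exp (- (1 + (norm x)\<^sup>2) * t\<^sup>2)) \<partial>lborel) \<partial>lborel)"
    by (rule nn_integral_cong, rule nn_integral_cmult) measurable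
  also have "\<dots> = (\<integral>\<^sup>+x. ennreal (V * fact d / (2 * pi ^ DIM('a)) *
      (indicator A x *\<^sub>R (1 / (1 + (norm x)\<^sup>2) ^ DIM('a)))) \<partial>lborel)"
  proof (rule nn_integral_cong)
    fix x :: 'a
    have "0 < 1 + (norm x)\<^sup>2" by (simp add: add_pos_nonneg)
    then show "indicator A x * ennreal (V / pi ^ DIM('a)) *
        (\<integral>\<^sup>+t. indicator {0<..} t * ennreal (t ^ (2 * d + 1) * exp (- (1 + (norm x)\<^sup>2) * t\<^sup>2)) \<partial>lborel) =
      ennreal (V * fact d / (2 * pi ^ DIM('a)) * (indicator A x *\<^sub>R (1 / (1 + (norm x)\<^sup>2) ^ DIM('a))))"
      \<comment> \<open>The moment with \<open>k = d\<close> has \<open>d + 1\<close>, the full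
        dimension, as the exponent in its denominator.\<close>
      unfolding nn_integral_gaussian_odd_moment[OF \<open>0 < 1 + (norm x)\<^sup>2\<close>] d[symmetric]
      using V by (auto simp: indicator_def mult_ac simp flip: ennreal_mult)
  qed
  finally have *: "(\<integral>\<^sup>+u. ennreal (hit_density_limit e A u) \<partial>lborel) =
    (\<integral>\<^sup>+x. ennreal (V * fact d / (2 * pi ^ DIM('a)) *
      (indicator A x *\<^sub>R (1 / (1 + (norm x)\<^sup>2) ^ DIM('a)))) \<partial>lborel)" .
  have "(\<integral>u. hit_density_limit e A u \<partial>lborel) =
      enn2real (\<integral>\<^sup>+u. ennreal (hit_density_limit e A u) \<partial>lborel)"
    by (intro enn2real_nn_integral_eq_integral[symmetric])
       (auto simp: hit_density_limit_def gauss_scaled_nonneg[OF A])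
  also have "\<dots> = (\<integral>x. V * fact d / (2 * pi ^ DIM('a)) *
      (indicator A x *\<^sub>R (1 / (1 + (norm x)\<^sup>2) ^ DIM('a))) \<partial>lborel)"
    unfolding * using V by (intro enn2real_nn_integral_eq_integral) auto
  also have "\<dots> = V * fact d / (2 * pi ^ DIM('a)) *
      (\<integral>x. indicator A x *\<^sub>R (1 / (1 + (norm x)\<^sup>2) ^ DIM('a)) \<partial>lborel)"
    by (rule integral_mult_right_zero)
  finally show ?thesis
    by (simp only: set_lebesgue_integral_def V_def d_def)
qed

section \<open>The collision probability\<close>

lemma std_normal_vec_density_measurable[measurable]:
  "std_normal_vec_density \<in> borel_measurable borel"
  unfolding std_normal_vec_density_def[abs_def] by measurable

lemma std_normal_vec_density_nonneg: "0 \<le> std_normal_vec_density x"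
  unfolding std_normal_vec_density_def by (intro prod_nonneg) auto

text \<open>In each coordinate the parallelogram law separates the exponent, which makes
  \<open>y\<close> and \<open>u\<close> independent. The constant becomes
  \<open>1 / pi ^ CARD('n)\<close> only after multiplication by the Jacobian of the
  substitution.\<close>

lemma std_normal_vec_density_sum_difference:
  fixes y u :: "real ^ 'n"
  shows "std_normal_vec_density (y + u) * std_normal_vec_density (y - u) =
    (1 / (2 * pi)) ^ CARD('n) * (exp (- (norm y)\<^sup>2) * exp (- (norm u)\<^sup>2))"
proof -
  have 1: "std_normal_density (a + b) * std_normal_density (a - b) =
      1 / (2 * pi) * (exp (- a\<^sup>2) * exp (- b\<^sup>2))" for a b :: real
  proof -
    have "std_normal_density (a + b) * std_normal_density (a - b) =
        1 / (sqrt (2 * pi) * sqrt (2 * pi)) * exp (- (a + b)\<^sup>2 / 2 + - (a - b)\<^sup>2 / 2)"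
      by (simp add: std_normal_density_def mult_exp_exp)
    also have "- (a + b)\<^sup>2 / 2 + - (a - b)\<^sup>2 / 2 = - a\<^sup>2 + - b\<^sup>2"
      by (simp add: power2_eq_square field_simps)
    finally show ?thesis by (simp only: exp_add) simp
  qed
  have 2: "exp (- (norm x)\<^sup>2) = (\<Prod>i\<in>UNIV. exp (- (x $ i)\<^sup>2))" for x :: "real ^ 'n"
    by (simp add: norm_vec_def L2_set_def sum_nonneg sum_negf flip: exp_sum)
  show ?thesis
    unfolding std_normal_vec_density_def 2 prod.distrib[symmetric]
    by (simp only: vector_add_component vector_minus_component 1 prod.distrib prod_constant)
qed

text \<open>The event is a condition on \<open>u\<close> and \<open>y\<close> alone. Integrating out
  \<open>y\<close> leaves \<open>hit_density\<close>, and squeezing isolates the power of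
  \<open>r\<close> exactly, before any limit.\<close>

lemma (in prob_space) prob_hit_in_set:
  fixes V1 V2 :: "'a \<Rightarrow> real ^ 'n" and e :: "real ^ 'n"
  assumes "distributed M lborel V1 (\<lambda>x. ennreal (std_normal_vec_density x))"
    and "distributed M lborel V2 (\<lambda>x. ennreal (std_normal_vec_density x))"
    and "indep_var borel V1 borel V2"
    and A[measurable]: "A \<in> sets borel" and e: "e \<in> Basis" and r: "0 < r" "r < 1"
  shows "prob {\<omega> \<in> space M.
      collision_time (cball (- e) r) (cball e r) (V1 \<omega>) (V2 \<omega>) < \<infinity> \<and>
      collision_location (cball (- e) r) (cball e r) (V1 \<omega>) (V2 \<omega>) \<in> A} =
    r ^ (CARD('n) - 1) * (\<integral>u. hit_density e A r (squeeze e r u) \<partial>lborel)"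
proof -
  let ?\<phi> = "std_normal_vec_density :: real ^ 'n \<Rightarrow> real"
  let ?hit = "\<lambda>u y. hits e r u \<and> (1 / hit_rate e r u) *\<^sub>R y \<in> A"
  let ?B = "{x. ?hit ((1 / 2) *\<^sub>R (fst x - snd x)) ((1 / 2) *\<^sub>R (fst x + snd x))}"
  \<comment> \<open>The indicator of \<open>?B\<close> is split into a factor for \<open>u\<close>
    and a factor for the contact point, so that the former can leave the inner integral over
    \<open>y\<close>.\<close>
  let ?f = "\<lambda>v w. ennreal (?\<phi> v) * ennreal (?\<phi> w) *
    indicator {u. hits e r u} ((1 / 2) *\<^sub>R (v - w)) *
    indicator A ((1 / hit_rate e r ((1 / 2) *\<^sub>R (v - w))) *\<^sub>R (1 / 2) *\<^sub>R (v + w))"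
  have e1: "norm e = 1" using e by simp
  have B: "?B \<in> sets (lborel \<Otimes>\<^sub>M lborel)"
  proof -
    have "{x \<in> space (lborel \<Otimes>\<^sub>M lborel). x \<in> ?B} \<in> sets (lborel \<Otimes>\<^sub>M lborel)"
      unfolding mem_Collect_eq by measurable
    then show ?thesis by (simp add: space_pair_measure)
  qed
  have f[measurable]: "(\<lambda>(v, w). ?f v w) \<in> borel_measurable (borel \<Otimes>\<^sub>M borel)"
    unfolding indicator_def[of "{u. hits e r u}"] mem_Collect_eq by measurable
  have event: "{\<omega> \<in> space M.
      collision_time (cball (- e) r) (cball e r) (V1 \<omega>) (V2 \<omega>) < \<infinity> \<and>
      collision_location (cball (- e) r) (cball e r) (V1 \<omega>) (V2 \<omega>) \<in> A} =
    (\<lambda>\<omega>. (V1 \<omega>, V2 \<omega>)) -` ?B \<inter> space M"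
  proof -
    have "collision_time (cball (- e) r) (cball e r) v w < \<infinity> \<and>
        collision_location (cball (- e) r) (cball e r) v w \<in> A \<longleftrightarrow> (v, w) \<in> ?B" for v w
    proof -
      define u y where "u = (1 / 2) *\<^sub>R (v - w)" and "y = (1 / 2) *\<^sub>R (v + w)"
      have "v = (1 / 2) *\<^sub>R (v + v)" "w = (1 / 2) *\<^sub>R (w + w)"
        by (simp_all flip: scaleR_2)
      then have vw: "v = y + u" "w = y - u"
        by (simp_all add: u_def y_def scaleR_add_right scaleR_diff_right)
      have B: "(v, w) \<in> ?B \<longleftrightarrow> ?hit u y"
        by (simp only: mem_Collect_eq fst_conv snd_conv u_def y_def)
      show ?thesis
        unfolding B unfolding vw
        by (simp add: collision_time_cball[OF e1 r] collision_location_cball[OF e1 r])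
    qed
    then show ?thesis by auto
  qed
  have "distributed M (lborel \<Otimes>\<^sub>M lborel) (\<lambda>\<omega>. (V1 \<omega>, V2 \<omega>))
      (\<lambda>(v, w). ennreal (?\<phi> v) * ennreal (?\<phi> w))"
  proof (rule distributed_joint_indep)
    \<comment> \<open>Independence depends only on the sigma-algebras, which \<open>borel\<close>
      and \<open>lborel\<close> share.\<close>
    show "indep_var lborel V1 lborel V2"
      using assms(3) by (simp add: indep_var_eq)
  qed (use assms in \<open>auto intro: lborel.sigma_finite_measure_axioms\<close>)
  then have "emeasure M ((\<lambda>\<omega>. (V1 \<omega>, V2 \<omega>)) -` ?B \<inter> space M) =
      (\<integral>\<^sup>+x. (case x of (v, w) \<Rightarrow> ennreal (?\<phi> v) * ennreal (?\<phi> w)) * indicator ?B x \<partial>(lborel \<Otimes>\<^sub>M lborel))"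
    using B by (rule distributed_emeasure)
  also have "\<dots> = (\<integral>\<^sup>+x. (case x of (v, w) \<Rightarrow> ?f v w) \<partial>(lborel \<Otimes>\<^sub>M lborel))"
    by (intro nn_integral_cong) (auto simp: indicator_def)
  also have "\<dots> = (\<integral>\<^sup>+w. \<integral>\<^sup>+v. ?f v w \<partial>lborel \<partial>lborel)"
    by (subst lborel_pair.nn_integral_snd[symmetric]) auto
  also have "\<dots> = ennreal (2 ^ CARD('n)) * (\<integral>\<^sup>+u. \<integral>\<^sup>+y. ?f (y + u) (y - u) \<partial>lborel \<partial>lborel)"
    using nn_integral_sum_difference[OF f] by simp
  also have "\<dots> = (\<integral>\<^sup>+u. ennreal (2 ^ CARD('n)) * (\<integral>\<^sup>+y. ?f (y + u) (y - u) \<partial>lborel) \<partial>lborel)"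
    by (intro nn_integral_cmult[symmetric]) measurable
  also have "\<dots> = (\<integral>\<^sup>+u. ennreal (hit_density e A r u) \<partial>lborel)"
  proof (rule nn_integral_cong)
    fix u :: "real ^ 'n"
    let ?c = "(1 / (2 * pi)) ^ CARD('n) * exp (- (norm u)\<^sup>2)"
    have "?f (y + u) (y - u) = ennreal ?c * indicator {u. hits e r u} u *
        (indicator A ((1 / hit_rate e r u) *\<^sub>R y) * ennreal (exp (- (norm y)\<^sup>2)))" for y
    proof -
      have "(1 / 2) *\<^sub>R ((y + u) - (y - u)) = u" "(1 / 2) *\<^sub>R ((y + u) + (y - u)) = y"
        by (simp_all flip: scaleR_2)
      moreover have "ennreal (?\<phi> (y + u)) * ennreal (?\<phi> (y - u)) = ennreal ?c * ennreal (exp (- (norm y)\<^sup>2))"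
        unfolding ennreal_mult[OF std_normal_vec_density_nonneg std_normal_vec_density_nonneg, symmetric]
          std_normal_vec_density_sum_difference
        by (simp add: mult_ac flip: ennreal_mult)
      ultimately show ?thesis by (simp only: mult_ac)
    qed
    then have "(\<integral>\<^sup>+y. ?f (y + u) (y - u) \<partial>lborel) =
        ennreal ?c * indicator {u. hits e r u} u * ennreal (gauss_scaled A (hit_rate e r u))"
      unfolding ennreal_gauss_scaled[OF A] by (simp only:) (rule nn_integral_cmult, measurable)
    \<comment> \<open>The factor \<open>2 ^ CARD('n)\<close> cancels against
      \<open>(1 / (2 * pi)) ^ CARD('n)\<close>, which leaves the power of \<open>pi\<close> in
      \<open>hit_density\<close>.\<close>
    then show "ennreal (2 ^ CARD('n)) * (\<integral>\<^sup>+y. ?f (y + u) (y - u) \<partial>lborel) = ennreal (hit_density e A r u)"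
      by (simp only:)
         (auto simp: hit_density_def indicator_def gauss_scaled_nonneg[OF A] power_mult_distrib
           power_divide simp flip: ennreal_mult)
  qed
  also have "\<dots> = ennreal (r ^ (CARD('n) - 1)) * (\<integral>\<^sup>+u. ennreal (hit_density e A r (squeeze e r u)) \<partial>lborel)"
    using nn_integral_squeeze[OF _ e r(1), of "\<lambda>u. ennreal (hit_density e A r u)"] A by simp
  finally have "prob ((\<lambda>\<omega>. (V1 \<omega>, V2 \<omega>)) -` ?B \<inter> space M) =
      r ^ (CARD('n) - 1) * enn2real (\<integral>\<^sup>+u. ennreal (hit_density e A r (squeeze e r u)) \<partial>lborel)"
    using r by (simp add: measure_def enn2real_mult)
  also have "enn2real (\<integral>\<^sup>+u. ennreal (hit_density e A r (squeeze e r u)) \<partial>lborel) =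
      (\<integral>u. hit_density e A r (squeeze e r u) \<partial>lborel)"
    by (intro enn2real_nn_integral_eq_integral)
       (auto simp: hit_density_def gauss_scaled_nonneg[OF A])
  finally show ?thesis unfolding event .
qed

text \<open>The unit ball in dimension \<open>n - 1\<close> brings
  \<open>pi powr (real (n - 1) / 2)\<close> and the Gamma value in the denominator, and the
  factorial is \<open>Gamma (real n)\<close>; the exponents of \<open>pi\<close> combine because
  \<open>(n - 1) / 2 - n = - (n + 1) / 2\<close>.\<close>

lemma collision_constant:
  assumes "0 < n"
  shows "unit_ball_vol (real (n - 1)) * fact (n - 1) / (2 * pi ^ n) =
    pi powr (- ((real n + 1) / 2)) * Gamma (real n) / (2 * Gamma (real n / 2 + 1 / 2))"
proof -
  have G: "Gamma (real n) = fact (n - 1)"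
    using Gamma_fact[of "n - 1", where 'a=real] assms by (simp add: of_nat_diff)
  have "pi powr (real (n - 1) / 2) / pi ^ n = pi powr (real (n - 1) / 2 - real n)"
    by (simp add: powr_diff powr_realpow)
  also have "real (n - 1) / 2 - real n = - ((real n + 1) / 2)"
    using assms by (simp add: of_nat_diff field_simps)
  finally have P: "pi powr (- ((real n + 1) / 2)) = pi powr (real (n - 1) / 2) / pi ^ n" by simp
  have "real (n - 1) / 2 + 1 = real n / 2 + 1 / 2"
    using assms by (simp add: of_nat_diff field_simps)
  then show ?thesis
    unfolding unit_ball_vol_def G P by (simp add: field_simps)
qed

theorem theorem2p8:
  fixes P :: "'w measure"
    and V1 V2 :: "'w \<Rightarrow> real ^ 'n"
    and k :: 'n
    and A :: "(real ^ 'n) set"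
  assumes "prob_space P"
    and "CARD('n) \<ge> 2"
    and "distributed P lborel V1 (\<lambda>x. ennreal (std_normal_vec_density x))"
    and "distributed P lborel V2 (\<lambda>x. ennreal (std_normal_vec_density x))"
    and "prob_space.indep_var P borel V1 borel V2"
    and "A \<in> sets borel"
    and "bounded A"
    and "(INF x\<in>A. ereal (dist 0 x)) > 0"
  shows "((\<lambda>r. measure P {\<omega> \<in> space P.
              collision_time (cball (axis k (- 1)) r) (cball (axis k 1) r) (V1 \<omega>) (V2 \<omega>) < \<infinity> \<and>
              collision_location (cball (axis k (- 1)) r) (cball (axis k 1) r) (V1 \<omega>) (V2 \<omega>) \<in> A}
            * r powr (1 - real CARD('n)))
          \<longlongrightarrow> pi powr (- ((real CARD('n) + 1) / 2)) * Gamma (real CARD('n))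
               / (2 * Gamma (real CARD('n) / 2 + 1 / 2))
               * (LINT x:A|lborel. 1 / (1 + (norm x)\<^sup>2) ^ CARD('n))) (at_right 0)"
proof -
  interpret prob_space P by fact
  let ?e = "axis k 1 :: real ^ 'n"
  have e: "?e \<in> Basis" by (simp add: axis_in_Basis_iff)
  have minus: "axis k (- 1) = - ?e" by (simp add: vec_eq_iff axis_def)
  have "((\<lambda>r. \<integral>u. hit_density ?e A r (squeeze ?e r u) \<partial>lborel) \<longlongrightarrow>
      (\<integral>u. hit_density_limit ?e A u \<partial>lborel)) (at_right 0)"
    using assms e by (intro tendsto_integral_hit_density_squeeze) auto
  also have "(\<integral>u. hit_density_limit ?e A u \<partial>lborel) =
      pi powr (- ((real CARD('n) + 1) / 2)) * Gamma (real CARD('n))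
        / (2 * Gamma (real CARD('n) / 2 + 1 / 2))
        * (LINT x:A|lborel. 1 / (1 + (norm x)\<^sup>2) ^ CARD('n))"
    using collision_constant[OF zero_less_card_finite, where 'a1='n]
    by (simp only: integral_hit_density_limit[OF assms(6) e] DIM_cart DIM_real mult_1_right)
  finally have lim: "((\<lambda>r. \<integral>u. hit_density ?e A r (squeeze ?e r u) \<partial>lborel) \<longlongrightarrow>
      pi powr (- ((real CARD('n) + 1) / 2)) * Gamma (real CARD('n))
        / (2 * Gamma (real CARD('n) / 2 + 1 / 2))
        * (LINT x:A|lborel. 1 / (1 + (norm x)\<^sup>2) ^ CARD('n))) (at_right 0)" .
  have "\<forall>\<^sub>F r in at_right 0. 0 < r \<and> r < (1::real)"
    by (simp add: eventually_at_right_field) (metis zero_less_one)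
  then have "\<forall>\<^sub>F r in at_right 0. (\<integral>u. hit_density ?e A r (squeeze ?e r u) \<partial>lborel) =
      prob {\<omega> \<in> space P.
        collision_time (cball (axis k (- 1)) r) (cball (axis k 1) r) (V1 \<omega>) (V2 \<omega>) < \<infinity> \<and>
        collision_location (cball (axis k (- 1)) r) (cball (axis k 1) r) (V1 \<omega>) (V2 \<omega>) \<in> A}
      * r powr (1 - real CARD('n))"
  proof eventually_elim
    case (elim r)
    \<comment> \<open>The normalising power cancels the Jacobian of the squeeze, so for every
      \<open>r\<close> in \<open>(0, 1)\<close> the rescaled probability equals the squeezed
      integral.\<close>
    have "r ^ (CARD('n) - 1) * r powr (1 - real CARD('n)) =
        r powr (real (CARD('n) - 1)) * r powr (1 - real CARD('n))"
      using elim by (simp only: powr_realpow)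
    also have "\<dots> = 1" using elim by (simp add: of_nat_diff flip: powr_add)
    finally have "r ^ (CARD('n) - 1) * r powr (1 - real CARD('n)) = 1" .
    then show ?case
      unfolding minus using elim prob_hit_in_set[OF assms(3,4,5,6) e, of r]
      by (simp add: mult.assoc mult.left_commute)
  qed
  with lim show ?thesis by (rule Lim_transform_eventually)
qed

end
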